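(* Let $G$ be a graph with clique number $\omega(G)$. Then $drn(G)\geq\omega(G)$.
   Context: All graphs are finite, simple and undirected. $\omega(G)$ is the maximum number of vertices of a clique of $G$. For a positive integer $k$, $[k]=\{1,\dots,k\}$ and $S_k$ is the group of permutations of $[k]$. A derangement $k$-representation of a graph $G$ is an injective map $\pi:V(G)\to S_k$ such that for any two distinct vertices $u,v$ of $G$, $u$ and $v$ are adjacent if and only if $\pi(v)(i)\neq\pi(u)(i)$ for all $i\in[k]$. The derangement representation number $drn(G)$ is the minimum $k$ such that $G$ has a derangement $k$-representation (every finite graph has one for some $k$, so this is well defined). *)

theory Defs
  imports "HOL-Library.Ramsey" "HOL-Combinatorics.Permutations"
begin

definition finite_simple_graph :: "'a set \<Rightarrow> 'a set set \<Rightarrow> bool" where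
  "finite_simple_graph V E \<longleftrightarrow> finite V \<and> E \<subseteq> nsets V 2"

definition clique_number :: "'a set \<Rightarrow> 'a set set \<Rightarrow> nat" where
  "clique_number V E = Max {card K | K. K \<subseteq> V \<and> clique K E}"

(* A member of S_k is a function on nat that permutes {1..k}; since permutes forces it
   to be the identity outside {1..k}, inj_on compares permutations of {1..k} as such. *)
definition derangement_representation ::
    "nat \<Rightarrow> 'a set \<Rightarrow> 'a set set \<Rightarrow> ('a \<Rightarrow> nat \<Rightarrow> nat) \<Rightarrow> bool" where
  "derangement_representation k V E \<pi> \<longleftrightarrow>
     (\<forall>v\<in>V. \<pi> v permutes {1..k}) \<and>
     inj_on \<pi> V \<and>
     (\<forall>u\<in>V. \<forall>v\<in>V. u \<noteq> v \<longrightarrow> ({u, v} \<in> E \<longleftrightarrow> (\<forall>i\<in>{1..k}. \<pi> v i \<noteq> \<pi> u i)))"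

(* LEAST is a genuine minimum for finite simple graphs, all of which have such a
   representation for some k > 0. *)
definition drn :: "'a set \<Rightarrow> 'a set set \<Rightarrow> nat" where
  "drn V E = (LEAST k. k > 0 \<and> (\<exists>\<pi>. derangement_representation k V E \<pi>))"

end

theory Submission
  imports Defs "HOL-Number_Theory.Cong"
begin

text \<open>
  The lower bound itself is short: the permutations assigned to the vertices of a clique
  disagree pairwise at every point of \<open>{1..k}\<close>, so evaluating them at the point \<open>1\<close> embeds
  the clique into \<open>{1..k}\<close> (\<open>clique_card_le\<close>). This bounds the clique number by every \<open>k > 0\<close>
  for which a representation exists.

  To speak about the least such \<open>k\<close> one has to know that some \<open>k\<close> exists at all
  (\<open>derangement_representation_exists\<close>). Take several proper colourings of the
  graph such that every non-edge is monochromatic in one of them and one of them is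
  injective. Cut \<open>{1..k}\<close> into one block per colouring and let a vertex rotate each block by
  its colour there. Two rotations of a block agree everywhere or nowhere according to whether
  the two colours are equal, so exactly the adjacent pairs of vertices disagree everywhere.
\<close>

lemma clique_card_le:
  assumes "derangement_representation k V E \<pi>" "k > 0" "K \<subseteq> V" "clique K E"
  shows "card K \<le> k"
proof -
  have one: "1 \<in> {1..k}"
    using assms(2) by simp
  have "inj_on (\<lambda>v. \<pi> v 1) K"
  proof (rule inj_onI, rule ccontr)
    fix u v assume uv: "u \<in> K" "v \<in> K" "\<pi> u 1 = \<pi> v 1" "u \<noteq> v"
    then have "{u, v} \<in> E"
      using assms(4) by (simp add: clique_def)
    then show False
      using assms(1,3) uv one unfolding derangement_representation_def by (metis subsetD)
  qed
  moreover have "(\<lambda>v. \<pi> v 1) ` K \<subseteq> {1..k}"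
  proof (rule image_subsetI)
    fix v assume "v \<in> K"
    then have "\<pi> v permutes {1..k}"
      using assms(1,3) by (auto simp: derangement_representation_def)
    then show "\<pi> v 1 \<in> {1..k}"
      using one by (simp only: permutes_in_image)
  qed
  ultimately have "card K \<le> card {1..k}"
    by (intro card_inj_on_le) auto
  then show ?thesis
    by simp
qed

text \<open>
  The points \<open>j * M + 1, \<dots>, j * M + M\<close> form the \<open>j\<close>-th block, which is rotated by \<open>s j\<close>.
\<close>

definition rotate_blocks :: "nat \<Rightarrow> nat \<Rightarrow> (nat \<Rightarrow> nat) \<Rightarrow> nat \<Rightarrow> nat" where
  "rotate_blocks m M s i =
     (if i \<in> {1..m * M}
      then Suc ((i - 1) div M * M + ((i - 1) mod M + s ((i - 1) div M)) mod M)
      else i)"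

lemma add_mod_right_cancel:
  fixes a b c M :: nat
  assumes "a < M" "b < M" "(a + c) mod M = (b + c) mod M"
  shows "a = b"
proof -
  have "[a + c = b + c] (mod M)"
    using assms(3) by (simp add: cong_def)
  then show ?thesis
    using assms(1,2) cong_less_modulus_unique_nat by (auto simp: cong_add_rcancel_nat)
qed

lemma rotate_blocks_permutes: "rotate_blocks m M s permutes {1..m * M}"
proof -
  have M: "M > 0" if "i \<in> {1..m * M}" for i
    using that by (cases M) auto
  have into: "rotate_blocks m M s i \<in> {1..m * M}" if i: "i \<in> {1..m * M}" for i
  proof -
    let ?j = "(i - 1) div M"
    have "i - 1 < m * M"
      using i by auto
    then have "Suc ?j * M \<le> m * M"
      by (intro mult_right_mono) (auto simp: less_mult_imp_div_less Suc_leI)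
    moreover have "((i - 1) mod M + s ?j) mod M < M"
      using M[OF i] by simp
    ultimately show ?thesis
      using i by (simp add: rotate_blocks_def)
  qed
  have "inj_on (rotate_blocks m M s) {1..m * M}"
  proof (rule inj_onI)
    fix i i' assume i: "i \<in> {1..m * M}" and i': "i' \<in> {1..m * M}"
      and eq: "rotate_blocks m M s i = rotate_blocks m M s i'"
    let ?j = "(i - 1) div M" and ?j' = "(i' - 1) div M"
    let ?r = "((i - 1) mod M + s ?j) mod M" and ?r' = "((i' - 1) mod M + s ?j') mod M"
    have eq': "?j * M + ?r = ?j' * M + ?r'"
      using eq i i' by (simp add: rotate_blocks_def)
    have j: "?j = ?j'"
      using arg_cong[OF eq', of "\<lambda>x. x div M"] M[OF i] by simp
    have "((i - 1) mod M + s ?j') mod M = ((i' - 1) mod M + s ?j') mod M"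
      using eq' unfolding j by (rule add_left_imp_eq)
    then have "(i - 1) mod M = (i' - 1) mod M"
      by (rule add_mod_right_cancel[rotated 2]) (use M[OF i] in simp_all)
    then have "i - 1 = i' - 1"
      using j by (metis div_mult_mod_eq)
    then show "i = i'"
      using i i' by auto
  qed
  then show ?thesis
    by (rule inj_imp_permutes) (use into in \<open>auto simp: rotate_blocks_def\<close>)
qed

lemma rotate_blocks_agree_iff:
  assumes "i \<in> {1..m * M}" "\<And>j. s j < M" "\<And>j. t j < M"
  shows "rotate_blocks m M s i = rotate_blocks m M t i \<longleftrightarrow> s ((i - 1) div M) = t ((i - 1) div M)"
proof -
  let ?j = "(i - 1) div M"
  have "s ?j = t ?j" if "((i - 1) mod M + s ?j) mod M = ((i - 1) mod M + t ?j) mod M"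
    using add_mod_right_cancel[OF assms(2,3)] that by (simp only: add.commute)
  then show ?thesis
    using assms(1) by (auto simp: rotate_blocks_def)
qed

lemma rotate_blocks_disagree_iff:
  assumes "\<And>j. s j < M" "\<And>j. t j < M"
  shows "(\<forall>i\<in>{1..m * M}. rotate_blocks m M s i \<noteq> rotate_blocks m M t i) \<longleftrightarrow>
         (\<forall>j<m. s j \<noteq> t j)"
proof -
  have M: "M > 0"
    using assms(1)[of 0] by simp
  have "(i - 1) div M < m" if "i \<in> {1..m * M}" for i
    using that by (intro less_mult_imp_div_less) auto
  moreover have "\<exists>i\<in>{1..m * M}. (i - 1) div M = j" if "j < m" for j
  proof
    have "Suc j * M \<le> m * M"
      using that by (intro mult_right_mono) auto
    then show "Suc (j * M) \<in> {1..m * M}"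
      using M by simp
  qed (use M in simp)
  ultimately show ?thesis
    using rotate_blocks_agree_iff[of _ m M s t] assms by metis
qed

text \<open>
  One colouring is injective; every non-edge contributes a further colouring, obtained from the
  injective one by giving the two ends of the non-edge a common new colour.
\<close>

lemma derangement_representation_exists:
  assumes "finite_simple_graph V E"
  shows "\<exists>k>0. \<exists>\<pi>. derangement_representation k V E \<pi>"
proof -
  have fin: "finite V"
    using assms by (simp add: finite_simple_graph_def)
  define F where "F = nsets V 2 - E"
  have "finite F"
    using fin by (simp add: F_def finite_imp_finite_nsets)
  then obtain e where e: "bij_betw e {..<card F} F"
    using ex_bij_betw_nat_finite[of F] by (auto simp: atLeast0LessThan)
  obtain idx where idx: "bij_betw idx V {..<card V}"
    using ex_bij_betw_finite_nat[OF fin] by (auto simp: atLeast0LessThan)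
  have idx_less: "idx v < card V" if "v \<in> V" for v
    using bij_betwE[OF idx] that by auto
  have idx_eq: "idx u = idx v \<longleftrightarrow> u = v" if "u \<in> V" "v \<in> V" for u v
    using idx that by (auto simp: bij_betw_def inj_on_eq_iff)
  define m where "m = Suc (card F)"
  define M where "M = Suc (card V)"
  define c where "c v j =
    (case j of 0 \<Rightarrow> idx v | Suc i \<Rightarrow> if v \<in> e i then card V else idx v)" for v j
  have c_less: "c v j < M" if "v \<in> V" for v j
    using idx_less[OF that] by (auto simp: c_def M_def split: nat.splits)
  have edge_iff: "{u, v} \<in> E \<longleftrightarrow> (\<forall>j<m. c v j \<noteq> c u j)" if "u \<in> V" "v \<in> V" "u \<noteq> v" for u v
  proof -
    have merged: "c v (Suc i) = c u (Suc i) \<longleftrightarrow> e i = {u, v}" if i: "i < card F" for i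
    proof -
      have "e i \<in> nsets V 2"
        using bij_betwE[OF e] i by (auto simp: F_def)
      then have "u \<in> e i \<and> v \<in> e i \<longleftrightarrow> e i = {u, v}"
        using \<open>u \<noteq> v\<close> by (auto simp: nsets_def card_2_iff)
      then show ?thesis
        using that(1) \<open>u \<in> V\<close> \<open>v \<in> V\<close> \<open>u \<noteq> v\<close> idx_less[of u] idx_less[of v] idx_eq[of v u]
        by (auto simp: c_def)
    qed
    have "{u, v} \<in> nsets V 2"
      using that by (auto simp: nsets_def)
    then have "{u, v} \<notin> E \<longleftrightarrow> {u, v} \<in> F"
      by (auto simp: F_def)
    also have "\<dots> \<longleftrightarrow> {u, v} \<in> e ` {..<card F}"
      by (simp only: bij_betw_imp_surj_on[OF e])
    also have "\<dots> \<longleftrightarrow> (\<exists>i<card F. e i = {u, v})"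
      by (auto simp only: image_iff lessThan_iff)
    also have "\<dots> \<longleftrightarrow> (\<exists>i<card F. c v (Suc i) = c u (Suc i))"
      using merged by auto
    also have "\<dots> \<longleftrightarrow> (\<exists>j<m. c v j = c u j)"
      unfolding m_def Ex_less_Suc2 using idx_eq[of v u] that by (simp add: c_def)
    finally show ?thesis
      by auto
  qed
  define \<pi> where "\<pi> v = rotate_blocks m M (c v)" for v
  have "inj_on \<pi> V"
  proof (rule inj_onI)
    fix u v assume uv: "u \<in> V" "v \<in> V" "\<pi> u = \<pi> v"
    \<comment> \<open>The point \<open>1\<close> lies in the first block, which is rotated by the injective colouring.\<close>
    have "rotate_blocks m M (c u) 1 = rotate_blocks m M (c v) 1"
      using uv(3) by (simp only: \<pi>_def)
    moreover have "1 \<in> {1..m * M}"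
      by (simp add: m_def M_def)
    ultimately have "c u 0 = c v 0"
      using rotate_blocks_agree_iff[of 1 m M "c u" "c v"] c_less uv(1,2) by simp
    then show "u = v"
      using uv idx_eq by (simp add: c_def)
  qed
  moreover have "{u, v} \<in> E \<longleftrightarrow> (\<forall>i\<in>{1..m * M}. \<pi> v i \<noteq> \<pi> u i)"
    if "u \<in> V" "v \<in> V" "u \<noteq> v" for u v
    unfolding \<pi>_def edge_iff[OF that]
    by (rule rotate_blocks_disagree_iff[symmetric]) (fact c_less[OF that(2)] c_less[OF that(1)])+
  moreover have "\<pi> v permutes {1..m * M}" for v
    unfolding \<pi>_def by (rule rotate_blocks_permutes)
  ultimately have "derangement_representation (m * M) V E \<pi>"
    unfolding derangement_representation_def by blast
  moreover have "m * M > 0"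
    by (simp add: m_def M_def)
  ultimately show ?thesis
    by blast
qed

theorem corollary9:
  fixes V :: "'a set" and E :: "'a set set"
  assumes "finite_simple_graph V E"
  shows "drn V E \<ge> clique_number V E"
proof -
  have "drn V E > 0 \<and> (\<exists>\<pi>. derangement_representation (drn V E) V E \<pi>)"
    unfolding drn_def by (rule LeastI_ex) (use derangement_representation_exists[OF assms] in blast)
  then obtain \<pi> where \<pi>: "drn V E > 0" "derangement_representation (drn V E) V E \<pi>"
    by blast
  let ?S = "{card K | K. K \<subseteq> V \<and> clique K E}"
  have bound: "\<forall>n\<in>?S. n \<le> drn V E"
    using clique_card_le[OF \<pi>(2,1)] by blast
  then have "finite ?S"
    by (meson finite_nat_set_iff_bounded_le)
  moreover have "card {} \<in> ?S"
    by (auto simp: clique_def intro!: exI[of _ "{}"])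
  ultimately show ?thesis
    unfolding clique_number_def using bound by (subst Max_le_iff) blast+
qed

end
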